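(* For a positive integer $n$, let $\mathcal{P}_n = \{(i,j)\in\mathbb{Z}^2 \mid 1\le i,j\le \sqrt{n}\}$ be the vertex set of the $\sqrt{n}\times\sqrt{n}$ integer lattice, and let $$Q_n = \left\{(a,p,b,q)\in \mathcal{P}_n^4 \mid |ap|=|bq|>0\right\}.$$ Then $|Q_n| = \Theta(n^3\log n)$ as $n\to\infty$; that is, there exist constants $c,C>0$ and $n_0$ such that $c\,n^3\log n\le |Q_n|\le C\,n^3\log n$ for all $n\ge n_0$.
   Context: Here $|ap|$ denotes the Euclidean distance between the points $a$ and $p$ in the plane. The quadruples in $Q_n$ are ordered (different orderings of the same points are counted as distinct elements), and the segments $ap$ and $bq$ are allowed to share endpoints or coincide. *)

theory Defs
  imports "HOL-Analysis.Analysis"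
begin

definition lattice_points :: "nat \<Rightarrow> (int \<times> int) set" where
  "lattice_points n =
     {(i, j). 1 \<le> i \<and> real_of_int i \<le> sqrt (real n) \<and> 1 \<le> j \<and> real_of_int j \<le> sqrt (real n)}"

(* The metric of the product type real * real is the Euclidean one (dist_prod_def). *)
definition plane_point :: "int \<times> int \<Rightarrow> real \<times> real" where
  "plane_point a = (real_of_int (fst a), real_of_int (snd a))"

definition eucl_dist :: "int \<times> int \<Rightarrow> int \<times> int \<Rightarrow> real" where
  "eucl_dist a p = dist (plane_point a) (plane_point p)"

definition equal_dist_quadruples ::
    "nat \<Rightarrow> ((int \<times> int) \<times> (int \<times> int) \<times> (int \<times> int) \<times> (int \<times> int)) set" where
  "equal_dist_quadruples n =
     {(a, p, b, q). a \<in> lattice_points n \<and> p \<in> lattice_points n \<and>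
        b \<in> lattice_points n \<and> q \<in> lattice_points n \<and>
        eucl_dist a p = eucl_dist b q \<and> eucl_dist b q > 0}"

end

theory Submission
  imports Defs "HOL-Number_Theory.Totient"
begin

text \<open>Let \<open>m\<close> be the integer part of \<open>sqrt n\<close>. Up to constants, a quadruple amounts to two base
  points, with about \<open>m\<^sup>4\<close> choices, and two difference vectors with
  \<open>x\<^sup>2 + y\<^sup>2 = z\<^sup>2 + w\<^sup>2\<close> and coordinates of size at most \<open>m\<close>. Factoring differences of
  squares turns the latter into solutions of \<open>s * t = s' * t'\<close>, which are parametrised by
  \<open>s = g * a\<close>, \<open>s' = g * b\<close>, \<open>t = b * h\<close>, \<open>t' = a * h\<close> with \<open>a\<close>, \<open>b\<close> coprime. For given
  \<open>a\<close>, \<open>b\<close> with maximum \<open>k\<close> there are about \<open>(m / k)\<^sup>2\<close> choices of \<open>g\<close>, \<open>h\<close>. Dropping coprimality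
  gives the upper bound \<open>m\<^sup>2 * (\<Sum>k\<le>m. k / k\<^sup>2)\<close>; keeping it gives the lower bound
  \<open>m\<^sup>2 * (\<Sum>k\<le>m. totient k / k\<^sup>2)\<close>, and both sums are of order \<open>ln m\<close>.\<close>

subsection \<open>Harmonic sums\<close>

text \<open>Telescoping against \<open>1 / n - 1 / (n + 1)\<close>. The induction needs the sharper
  bound \<open>2 - 1 / n\<close>, which starts at \<open>n = 1\<close>.\<close>

lemma sum_inverse_squares_le: "(\<Sum>e=1..n. 1 / real e ^ 2) \<le> 2"
proof -
  have "(\<Sum>e=1..n. 1 / real e ^ 2) \<le> 2 - 1 / real n" if "n \<ge> 1" for n
    using that
  proof (induction n rule: nat_induct_at_least)
    case (Suc n)
    have "1 / real (Suc n) ^ 2 \<le> 1 / (real n * real (Suc n))"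
      using Suc.hyps by (intro divide_left_mono) (auto simp: power2_eq_square)
    also have "\<dots> = 1 / real n - 1 / real (Suc n)"
      using Suc.hyps by (simp add: field_simps)
    finally show ?case
      using Suc.IH by simp
  qed simp
  from this[of n] show ?thesis
    by (cases "n = 0") (auto intro: order_trans)
qed

text \<open>The difference of harmonic number and logarithm decreases from its value 1 at
  \<open>n = 1\<close>; the library sequence is indexed from 0, hence \<open>n - 1\<close>.\<close>

lemma harm_le_one_plus_ln:
  assumes "n \<ge> 1"
  shows "harm n \<le> 1 + ln (real n)"
  using decseqD[OF decseq_harm_diff_ln, of 0 "n - 1"] assms by (simp add: harm_expand)

text \<open>Insert \<open>b = (\<Sum>d | d dvd b. totient d)\<close> into the harmonic sum and write \<open>b = d * e\<close>;
  the sum over \<open>e\<close> is bounded.\<close>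

lemma harm_le_sum_totient: "harm n \<le> 2 * (\<Sum>d=1..n. real (totient d) / real d ^ 2)"
proof -
  define A where "A = (SIGMA b:{1..n}. {d. d dvd b})"
  define f where "f = (\<lambda>(d, e). real (totient d) / real d ^ 2 * (1 / real e ^ 2))"
  have pos: "d > 0" if "d dvd b" "b \<ge> 1" for b d :: nat
    using that by (metis dvd_0_left_iff gr0I not_one_le_zero)
  have "harm n = (\<Sum>b=1..n. real b / real b ^ 2)"
    unfolding harm_def by (intro sum.cong) (auto simp: power2_eq_square field_simps)
  also have "\<dots> = (\<Sum>b=1..n. \<Sum>d | d dvd b. real (totient d) / real b ^ 2)"
    by (subst totient_divisor_sum [symmetric]) (simp add: sum_divide_distrib)
  also have "\<dots> = (\<Sum>(b, d)\<in>A. real (totient d) / real b ^ 2)"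
    unfolding A_def by (rule sum.Sigma) auto
  also have "\<dots> = (\<Sum>x\<in>A. f (case x of (b, d) \<Rightarrow> (d, b div d)))"
    by (intro sum.cong)
       (auto simp: A_def f_def power_mult_distrib dest!: pos elim!: dvdE)
  also have "\<dots> = sum f ((\<lambda>(b, d). (d, b div d)) ` A)"
    by (subst sum.reindex) (auto simp: inj_on_def A_def)
  also have "\<dots> \<le> sum f ({1..n} \<times> {1..n})"
  proof (intro sum_mono2)
    show "(\<lambda>(b, d). (d, b div d)) ` A \<subseteq> {1..n} \<times> {1..n}"
    proof clarsimp
      fix b d assume "(b, d) \<in> A"
      then have bd: "d dvd b" "1 \<le> b" "b \<le> n"
        by (auto simp: A_def)
      then have "0 < b div d"
        by (simp add: dvd_imp_le div_greater_zero_iff pos)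
      then show "Suc 0 \<le> d \<and> d \<le> n \<and> Suc 0 \<le> b div d \<and> b div d \<le> n"
        using bd pos[of d b] dvd_imp_le[of d b] div_le_dividend[of b d] by linarith
    qed
  qed (auto simp: f_def)
  also have "\<dots> = (\<Sum>d=1..n. real (totient d) / real d ^ 2 * (\<Sum>e=1..n. 1 / real e ^ 2))"
    unfolding f_def sum.cartesian_product [symmetric] by (simp add: sum_distrib_left)
  also have "\<dots> \<le> (\<Sum>d=1..n. real (totient d) / real d ^ 2 * 2)"
    by (intro sum_mono mult_left_mono sum_inverse_squares_le) auto
  finally show ?thesis
    by (simp add: sum_distrib_left mult.commute)
qed

subsection \<open>Equal products\<close>

definition equal_products :: "nat \<Rightarrow> (int \<times> int \<times> int \<times> int) set" where
  "equal_products N =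
     {(s, t, s', t'). {s, t, s', t'} \<subseteq> {- int N..int N} \<and> s * t = s' * t'}"

text \<open>For \<open>k >= 1\<close>, the sphere of radius \<open>k\<close> in the maximum norm, as
  two pairs of opposite sides. The corners lie in both pairs.\<close>

definition square_frame :: "nat \<Rightarrow> (int \<times> int) set" where
  "square_frame k = {- int k, int k} \<times> {- int k..int k} \<union> {- int k..int k} \<times> {- int k, int k}"

lemma card_square_frame_le:
  assumes "k \<ge> 1"
  shows "card (square_frame k) \<le> 12 * k"
proof -
  have "card (square_frame k) \<le> 2 * (2 * k + 1) + (2 * k + 1) * 2"
    unfolding square_frame_def
    using assms by (intro order_trans[OF card_Un_le] add_mono) auto
  then show ?thesis
    using assms by simp
qed

text \<open>Dividing \<open>s\<close> and \<open>s'\<close> by their gcd \<open>g\<close> leaves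
  coprime \<open>a\<close>, \<open>b\<close>, and \<open>a * t = b * t'\<close> then forces a common
  \<open>h\<close>. The gcd vanishes only for \<open>s = s' = 0\<close>, the family listed first. A
  covering suffices, so coprimality is not recorded.\<close>

lemma equal_products_subset:
  "equal_products N \<subseteq>
     (\<lambda>(t, t'). (0, t, 0, t')) ` ({- int N..int N} \<times> {- int N..int N}) \<union>
     (\<lambda>((a, b), (g, h)). (g * a, b * h, g * b, a * h)) `
       (\<Union>k\<in>{1..N}. square_frame k \<times>
          ({- int (N div k)..int (N div k)} \<times> {- int (N div k)..int (N div k)}))"
  (is "_ \<subseteq> ?Z \<union> ?f ` ?P")
proof clarify
  fix s t s' t' :: int
  assume st: "(s, t, s', t') \<in> equal_products N"
    and nz: "(s, t, s', t') \<notin> ?f ` ?P"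
  from st have bnd: "\<bar>s\<bar> \<le> int N" "\<bar>t\<bar> \<le> int N" "\<bar>s'\<bar> \<le> int N" "\<bar>t'\<bar> \<le> int N"
    and eq: "s * t = s' * t'"
    by (auto simp: equal_products_def)
  show "(s, t, s', t') \<in> ?Z"
  proof (cases "s = 0 \<and> s' = 0")
    case True
    then show ?thesis
      using bnd by (auto simp: image_iff)
  next
    case False
    define g where "g = gcd s s'"
    have "g > 0"
      using False by (auto simp: g_def)
    then obtain a b where "s = a * g" "s' = b * g" and cop: "coprime a b"
      using gcd_coprime_exists[of s s'] unfolding g_def by (metis less_irrefl)
    then have s: "s = g * a" and s': "s' = g * b"
      by (simp_all only: mult.commute)
    have ab: "a * t = b * t'"
      using eq \<open>g > 0\<close> by (simp add: s s')
    obtain h where t: "t = b * h" and t': "t' = a * h"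
    proof (cases "b = 0")
      case True
      then have "\<bar>a\<bar> = 1"
        using cop by simp
      \<comment> \<open>Here \<open>t = 0\<close> and \<open>a * a = 1\<close>, so
        \<open>h = a * t'\<close> serves.\<close>
      then have "t = b * (a * t')" "t' = a * (a * t')"
        using ab True by (auto simp: abs_if split: if_splits)
      then show ?thesis
        using that by blast
    next
      case False
      have "b dvd t"
        using ab cop by (metis coprime_commute coprime_dvd_mult_right_iff dvd_triv_left)
      then obtain h where h: "t = b * h" ..
      then have "t' = a * h"
        using ab False by (simp add: mult.left_commute)
      with h show ?thesis
        using that by blast
    qed
    define k where "k = nat (max \<bar>a\<bar> \<bar>b\<bar>)"
    have "a \<noteq> 0 \<or> b \<noteq> 0"
      using False s s' by auto
    then have k: "k \<ge> 1" "int k = max \<bar>a\<bar> \<bar>b\<bar>"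
      by (auto simp: k_def)
    have frame: "(a, b) \<in> square_frame k"
      unfolding square_frame_def k by (auto simp: max_def abs_if)
    \<comment> \<open>One of \<open>a\<close>, \<open>b\<close> has absolute value \<open>k\<close>,
      so one of \<open>s\<close>, \<open>s'\<close> has size \<open>|g| * k\<close> and one of
      \<open>t\<close>, \<open>t'\<close> has size \<open>|h| * k\<close>.\<close>
    have gk: "\<bar>g\<bar> * int k \<le> int N" "\<bar>h\<bar> * int k \<le> int N"
      using bnd unfolding s s' t t' k(2) abs_mult by (auto simp: max_def mult.commute)
    have "1 * int k \<le> \<bar>g\<bar> * int k"
      using \<open>g > 0\<close> by (intro mult_right_mono) auto
    then have "k \<le> N"
      using gk by simp
    moreover have "\<bar>x\<bar> \<le> int (N div k)" if "\<bar>x\<bar> * int k \<le> int N" for x :: int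
    proof -
      have "int (nat \<bar>x\<bar> * k) \<le> int N"
        using that by simp
      then have "nat \<bar>x\<bar> \<le> N div k"
        using k(1) by (simp only: of_nat_le_iff less_eq_div_iff_mult_less_eq)
      then show ?thesis
        by linarith
    qed
    from this[OF gk(1)] this[OF gk(2)]
    have "\<bar>g\<bar> \<le> int (N div k)" "\<bar>h\<bar> \<le> int (N div k)" .
    ultimately have "((a, b), (g, h)) \<in> ?P"
      using frame k(1) by (auto simp: abs_le_iff)
    then have "?f ((a, b), (g, h)) \<in> ?f ` ?P"
      by (rule imageI)
    with nz show ?thesis
      by (simp add: s s' t t')
  qed
qed

lemma finite_equal_products: "finite (equal_products N)"
  by (rule finite_subset[OF equal_products_subset]) (auto simp: square_frame_def)

text \<open>Frame \<open>k\<close> contributes at most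
  \<open>12 * k * (3 * N / k)^2 = 108 * N^2 / k\<close>. The degenerate family adds at most
  \<open>9 * N^2\<close>, absorbed because \<open>harm N >= 1\<close>.\<close>

lemma card_equal_products_le:
  assumes "N \<ge> 1"
  shows "real (card (equal_products N)) \<le> 117 * real N ^ 2 * harm N"
proof -
  define B where "B = (\<lambda>r. {- int r..int r})"
  define P where "P = (\<lambda>k. square_frame k \<times> (B (N div k) \<times> B (N div k)))"
  have finB: "finite (B r)" and cardB: "card (B r) = 2 * r + 1" for r
    by (auto simp: B_def)
  have finP: "finite (P k)" for k
    by (auto simp: P_def finB square_frame_def)
  have P: "real (card (P k)) \<le> 108 * real N ^ 2 * inverse (real k)" if k: "k \<in> {1..N}" for k
  proof -
    have "1 \<le> N div k"
      using k by (simp add: Suc_le_eq div_greater_zero_iff)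
    then have "2 * real (N div k) + 1 \<le> 3 * real (N div k)"
      by simp
    also have "\<dots> \<le> 3 * (real N / real k)"
      using of_nat_div_le_of_nat[of N k, where 'a = real] by simp
    finally have d: "2 * real (N div k) + 1 \<le> 3 * (real N / real k)" .
    have "real (card (P k)) = real (card (square_frame k)) * (2 * real (N div k) + 1) ^ 2"
      by (simp add: P_def card_cartesian_product cardB power2_eq_square algebra_simps)
    also have "\<dots> \<le> (12 * real k) * (3 * (real N / real k)) ^ 2"
      using of_nat_mono[OF card_square_frame_le[of k], where 'a = real] k d
      by (intro mult_mono power_mono) auto
    also have "\<dots> = 108 * real N ^ 2 * inverse (real k)"
      using k by (simp add: field_simps power2_eq_square)
    finally show ?thesis .
  qed
  have "card (equal_products N) \<le>
      card ((\<lambda>(t, t'). (0::int, t, 0::int, t')) ` (B N \<times> B N) \<union>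
        (\<lambda>((a, b), (g, h)). (g * a, b * h, g * b, a * h)) ` (\<Union>k\<in>{1..N}. P k))"
    unfolding B_def P_def
    by (intro card_mono equal_products_subset) (auto simp: square_frame_def)
  also have "\<dots> \<le> card (B N \<times> B N) + card (\<Union>k\<in>{1..N}. P k)"
    by (intro order_trans[OF card_Un_le] add_mono card_image_le) (auto simp: finB finP)
  also have "\<dots> \<le> (2 * N + 1) ^ 2 + (\<Sum>k=1..N. card (P k))"
    by (intro add_mono card_UN_le) (simp_all add: card_cartesian_product cardB power2_eq_square)
  finally have "real (card (equal_products N)) \<le> real ((2 * N + 1) ^ 2 + (\<Sum>k=1..N. card (P k)))"
    by (simp only: of_nat_le_iff)
  also have "\<dots> = (2 * real N + 1) ^ 2 + (\<Sum>k=1..N. real (card (P k)))"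
    by simp
  also have "\<dots> \<le> (3 * real N) ^ 2 + (\<Sum>k=1..N. 108 * real N ^ 2 * inverse (real k))"
    using assms by (intro add_mono power_mono sum_mono P) auto
  also have "\<dots> = 9 * real N ^ 2 * 1 + 108 * real N ^ 2 * harm N"
    by (simp add: harm_def sum_distrib_left power_mult_distrib)
  also have "\<dots> \<le> 9 * real N ^ 2 * harm N + 108 * real N ^ 2 * harm N"
    using harm_mono[OF assms, where 'a = real]
    by (intro add_mono mult_left_mono) (auto simp: harm_expand)
  finally show ?thesis
    by (simp add: algebra_simps)
qed

text \<open>A parameter \<open>(b, a, g, h)\<close> stands for the equal products
  \<open>(g * a) * (h * b) = (g * b) * (h * a)\<close>; coprimality of \<open>a\<close> and \<open>b\<close> makes this injective.\<close>

definition product_params :: "nat \<Rightarrow> (nat \<times> nat \<times> nat \<times> nat) set" where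
  "product_params N = (SIGMA b:{1..N}. totatives b \<times> {1..N div b} \<times> {1..N div b})"

text \<open>Rounding down at most halves \<open>N / b\<close> when \<open>b <= N\<close>. Squaring
  costs 4 and the totient sum another 2, hence 8.\<close>

lemma card_product_params_ge: "real N ^ 2 * harm N / 8 \<le> real (card (product_params N))"
proof -
  have "real N ^ 2 * harm N / 8 \<le> real N ^ 2 * (2 * (\<Sum>b=1..N. real (totient b) / real b ^ 2)) / 8"
    by (intro divide_right_mono mult_left_mono harm_le_sum_totient) auto
  also have "\<dots> = (\<Sum>b=1..N. real (totient b) * (real N / (2 * real b)) ^ 2)"
    by (simp add: sum_distrib_left sum_divide_distrib power_divide power_mult_distrib mult_ac)
  also have "\<dots> \<le> (\<Sum>b=1..N. real (totient b) * real (N div b) ^ 2)"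
  proof (intro sum_mono mult_left_mono power_mono)
    fix b assume b: "b \<in> {1..N}"
    have "1 \<le> N div b"
      using b by (simp add: Suc_le_eq div_greater_zero_iff)
    moreover have "N mod b < b"
      using b by simp
    ultimately have "N < 2 * (N div b) * b"
      using div_mult_mod_eq[of N b] mult_le_mono1[of 1 "N div b" b] by linarith
    then have "real N < real (2 * (N div b) * b)"
      by (simp only: of_nat_less_iff)
    then show "real N / (2 * real b) \<le> real (N div b)"
      using b by (simp add: field_simps)
  qed auto
  also have "\<dots> = real (card (product_params N))"
    by (simp add: product_params_def card_SigmaI card_cartesian_product totient_def power2_eq_square)
  finally show ?thesis .
qed

lemma coprime_scaled_eqD:
  fixes a b a' b' g g' :: nat
  assumes "coprime a b" "coprime a' b'" "g * a = g' * a'" "g * b = g' * b'" "g > 0"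
  shows "g = g' \<and> a = a' \<and> b = b'"
proof -
  have "g = gcd (g * a) (g * b)" "g' = gcd (g' * a') (g' * b')"
    using assms(1,2) by (simp_all add: gcd_mult_left coprime_iff_gcd_eq_1)
  then have "g = g'"
    using assms by simp
  then show ?thesis
    using assms by simp
qed

lemma inj_on_product_params:
  "inj_on (\<lambda>(b, a, g, h). (g * a, h * b, g * b, h * a)) (product_params N)"
proof -
  \<comment> \<open>Three entries suffice: the gcd of \<open>g * a\<close> and \<open>g * b\<close>
    gives back \<open>g\<close>, hence \<open>a\<close> and \<open>b\<close>, and
    \<open>h * a\<close> then gives \<open>h\<close>.\<close>
  have "b = b' \<and> a = a' \<and> g = g' \<and> h = h'"
    if "(b, a, g, h) \<in> product_params N" "(b', a', g', h') \<in> product_params N"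
      "g * a = g' * a'" "g * b = g' * b'" "h * a = h' * a'" for b a g h b' a' g' h'
  proof -
    have "coprime a b" "coprime a' b'" "g > 0" "a' > 0"
      using that by (auto simp: product_params_def in_totatives_iff)
    then show ?thesis
      using coprime_scaled_eqD[of a b a' b' g g'] that by simp
  qed
  then show ?thesis
    unfolding inj_on_def by fast
qed

text \<open>Positive entries will make \<open>t' + s'\<close> positive, so the distances built from
  them are nonzero.\<close>

definition positive_equal_products :: "nat \<Rightarrow> (nat \<times> nat \<times> nat \<times> nat) set" where
  "positive_equal_products N =
     {(s, t, s', t'). {s, t, s', t'} \<subseteq> {1..N} \<and> s * t = s' * t'}"

lemma card_positive_equal_products_ge:
  "real N ^ 2 * harm N / 8 \<le> real (card (positive_equal_products N))"
proof -
  let ?f = "\<lambda>(b, a, g, h). (g * a, h * b, g * b, h * a) :: nat \<times> nat \<times> nat \<times> nat"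
  have bound: "x * y \<in> {1..N}" if "1 \<le> x" "x \<le> N div b" "1 \<le> y" "y \<le> b" for x y b
    using that order_trans[OF mult_le_mono[of x "N div b" y b] div_times_less_eq_dividend]
    by simp
  have "?f ` product_params N \<subseteq> positive_equal_products N"
  proof clarify
    fix b a g h assume "(b, a, g, h) \<in> product_params N"
    then have "1 \<le> g" "g \<le> N div b" "1 \<le> h" "h \<le> N div b" "1 \<le> a" "a \<le> b" "1 \<le> b"
      by (auto simp: product_params_def in_totatives_iff)
    then show "(g * a, h * b, g * b, h * a) \<in> positive_equal_products N"
      using bound[of g b a] bound[of h b b] bound[of g b b] bound[of h b a]
      unfolding positive_equal_products_def by (simp add: mult_ac)
  qed
  moreover have "finite (positive_equal_products N)"
    by (rule finite_subset[of _ "{1..N} \<times> {1..N} \<times> {1..N} \<times> {1..N}"])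
       (auto simp: positive_equal_products_def)
  ultimately have "card (product_params N) \<le> card (positive_equal_products N)"
    using inj_on_product_params by (intro card_inj_on_le)
  then show ?thesis
    using card_product_params_ge[of N] by linarith
qed

subsection \<open>Equal distances in the grid\<close>

lemma lattice_points_eq:
  "lattice_points n = {1..int (nat \<lfloor>sqrt (real n)\<rfloor>)} \<times> {1..int (nat \<lfloor>sqrt (real n)\<rfloor>)}"
  by (auto simp: lattice_points_def le_floor_iff)

lemma eucl_dist_eq:
  "eucl_dist a p = sqrt (of_int ((fst p - fst a) ^ 2 + (snd p - snd a) ^ 2))"
  by (simp add: eucl_dist_def plane_point_def dist_prod_def dist_real_def power2_commute)

lemma equal_dist_quadruples_iff:
  "((a1, a2), (p1, p2), (b1, b2), (q1, q2)) \<in> equal_dist_quadruples n \<longleftrightarrow>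
     {a1, a2, p1, p2, b1, b2, q1, q2} \<subseteq> {1..int (nat \<lfloor>sqrt (real n)\<rfloor>)} \<and>
     (p1 - a1) ^ 2 + (p2 - a2) ^ 2 = (q1 - b1) ^ 2 + (q2 - b2) ^ 2 \<and>
     (q1 - b1) ^ 2 + (q2 - b2) ^ 2 > 0"
  unfolding equal_dist_quadruples_def lattice_points_eq eucl_dist_eq
  by (simp only: mem_Collect_eq case_prod_conv fst_conv snd_conv real_sqrt_eq_iff
        real_sqrt_gt_0_iff of_int_eq_iff of_int_0_less_iff mem_Sigma_iff insert_subset
        empty_subsetI) blast

lemma finite_equal_dist_quadruples: "finite (equal_dist_quadruples n)"
  by (rule finite_subset[of _ "lattice_points n \<times> lattice_points n \<times> lattice_points n \<times> lattice_points n"])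
     (auto simp: equal_dist_quadruples_def lattice_points_eq)

text \<open>\<open>x\<^sup>2 + y\<^sup>2 = z\<^sup>2 + w\<^sup>2\<close> is the equation
  \<open>(x - z) * (x + z) = (w - y) * (w + y)\<close>.\<close>

lemma card_equal_dist_quadruples_le:
  assumes "m = nat \<lfloor>sqrt (real n)\<rfloor>"
  shows "card (equal_dist_quadruples n) \<le> m ^ 4 * card (equal_products (2 * m))"
proof -
  define L where "L = {1..int m} \<times> {1..int m}"
  define F :: "(int \<times> int) \<times> (int \<times> int) \<times> (int \<times> int) \<times> (int \<times> int) \<Rightarrow> _" where
    "F = (\<lambda>((a1, a2), (p1, p2), (b1, b2), (q1, q2)).
       ((a1, a2), (b1, b2), (p1 - a1) - (q1 - b1), (p1 - a1) + (q1 - b1),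
        (q2 - b2) - (p2 - a2), (q2 - b2) + (p2 - a2)))"
  \<comment> \<open>Sums and differences of the last four entries recover twice each coordinate of
    \<open>p - a\<close> and \<open>q - b\<close>.\<close>
  have "inj_on F (equal_dist_quadruples n)"
    by (auto simp: inj_on_def F_def)
  moreover have "F ` equal_dist_quadruples n \<subseteq> L \<times> L \<times> equal_products (2 * m)"
    unfolding image_subset_iff Ball_def split_paired_All
  proof (intro allI impI)
    fix a1 a2 p1 p2 b1 b2 q1 q2
    assume "((a1, a2), (p1, p2), (b1, b2), (q1, q2)) \<in> equal_dist_quadruples n"
    then have bnd: "{a1, a2, p1, p2, b1, b2, q1, q2} \<subseteq> {1..int m}"
      and eq: "(p1 - a1) ^ 2 + (p2 - a2) ^ 2 = (q1 - b1) ^ 2 + (q2 - b2) ^ 2"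
      unfolding equal_dist_quadruples_iff assms by auto
    have "((p1 - a1) - (q1 - b1)) * ((p1 - a1) + (q1 - b1)) =
        ((q2 - b2) - (p2 - a2)) * ((q2 - b2) + (p2 - a2))"
      using eq by (simp add: power2_eq_square algebra_simps)
    then show "F ((a1, a2), (p1, p2), (b1, b2), (q1, q2)) \<in> L \<times> L \<times> equal_products (2 * m)"
      using bnd unfolding F_def L_def equal_products_def by auto
  qed
  ultimately have "card (equal_dist_quadruples n) \<le> card (L \<times> L \<times> equal_products (2 * m))"
    by (rule card_inj_on_le) (auto simp: L_def finite_equal_products)
  also have "\<dots> = m ^ 4 * card (equal_products (2 * m))"
    by (simp add: L_def card_cartesian_product power4_eq_xxxx)
  finally show ?thesis .
qed

text \<open>The base points stay at distance \<open>2 * N\<close> from the boundary, so that every difference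
  vector with coordinates of size at most \<open>2 * N\<close> can be attached to them.\<close>

lemma card_equal_dist_quadruples_ge:
  assumes m: "m = nat \<lfloor>sqrt (real n)\<rfloor>" and N: "8 * N \<le> m"
  shows "(real m / 2) ^ 4 * real (card (positive_equal_products N))
    \<le> real (card (equal_dist_quadruples n))"
proof -
  define G where "G = {2 * int N + 1..int m - 2 * int N} \<times> {2 * int N + 1..int m - 2 * int N}"
  \<comment> \<open>The differences are \<open>(s + t, t' - s')\<close> and
    \<open>(t - s, t' + s')\<close>. Equality of their norms reads
    \<open>4 * s * t = 4 * s' * t'\<close>; nothing is halved, so no parity condition
    arises.\<close>
  define F :: "(int \<times> int) \<times> (int \<times> int) \<times> (nat \<times> nat \<times> nat \<times> nat) \<Rightarrow> _" where
    "F = (\<lambda>((a1, a2), (b1, b2), (s, t, s', t')).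
       ((a1, a2), (a1 + (int s + int t), a2 + (int t' - int s')),
        (b1, b2), (b1 + (int t - int s), b2 + (int t' + int s'))))"
  have cardG: "(real m / 2) ^ 2 \<le> real (card G)"
  proof -
    have "card G = (m - 4 * N) ^ 2"
    proof -
      have "nat (int m - 4 * int N) = m - 4 * N"
        by linarith
      then show ?thesis
        by (simp add: G_def card_cartesian_product power2_eq_square)
    qed
    moreover have "real m / 2 \<le> real (m - 4 * N)"
      using N by linarith
    ultimately show ?thesis
      by (simp add: power_mono)
  qed
  have "inj F"
    by (auto simp: inj_on_def F_def)
  then have "inj_on F (G \<times> G \<times> positive_equal_products N)"
    by (rule inj_on_subset) simp
  moreover have "F ` (G \<times> G \<times> positive_equal_products N) \<subseteq> equal_dist_quadruples n"
    unfolding image_subset_iff Ball_def split_paired_All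
  proof (intro allI impI)
    fix a1 a2 b1 b2 s t s' t'
    assume "((a1, a2), (b1, b2), (s, t, s', t')) \<in> G \<times> G \<times> positive_equal_products N"
    then have base: "{a1, a2, b1, b2} \<subseteq> {2 * int N + 1..int m - 2 * int N}"
      and bnd: "{int s, int t, int s', int t'} \<subseteq> {1..int N}" and eq: "s * t = s' * t'"
      by (auto simp: G_def positive_equal_products_def)
    have "int s * int t = int s' * int t'"
      using eq by (simp flip: of_nat_mult)
    then have "(int s + int t) ^ 2 + (int t' - int s') ^ 2 =
        (int t - int s) ^ 2 + (int t' + int s') ^ 2"
      by (simp add: power2_eq_square algebra_simps)
    moreover have "0 < int t' + int s'"
      using bnd by auto
    then have "0 < (int t - int s) ^ 2 + (int t' + int s') ^ 2"
      by (intro add_nonneg_pos) auto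
    moreover have "{a1, a2, a1 + (int s + int t), a2 + (int t' - int s'),
        b1, b2, b1 + (int t - int s), b2 + (int t' + int s')} \<subseteq> {1..int m}"
      using base bnd by auto
    ultimately show "F ((a1, a2), (b1, b2), (s, t, s', t')) \<in> equal_dist_quadruples n"
      unfolding F_def case_prod_conv equal_dist_quadruples_iff m
      by (simp only: add_diff_cancel_left')
  qed
  ultimately have "card (G \<times> G \<times> positive_equal_products N) \<le> card (equal_dist_quadruples n)"
    using finite_equal_dist_quadruples by (rule card_inj_on_le)
  then have "real (card G * card G * card (positive_equal_products N))
      \<le> real (card (equal_dist_quadruples n))"
    by (simp only: card_cartesian_product of_nat_le_iff mult.assoc)
  moreover have "(real m / 2) ^ 4 * real (card (positive_equal_products N))
      \<le> real (card G * card G * card (positive_equal_products N))"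
  proof -
    have "(real m / 2) ^ 4 = (real m / 2) ^ 2 * (real m / 2) ^ 2"
      by (simp flip: power_add)
    also have "\<dots> \<le> real (card G) * real (card G)"
      by (intro mult_mono cardG) auto
    finally show ?thesis
      unfolding of_nat_mult by (intro mult_right_mono) auto
  qed
  ultimately show ?thesis
    by linarith
qed

section \<open>From the side length \<open>m\<close> back to \<open>n\<close>, and the
  constants\<close>

lemma floor_sqrt_bounds:
  assumes "m = nat \<lfloor>sqrt (real n)\<rfloor>" "n \<ge> 1"
  shows "m \<ge> 1" "real m ^ 2 \<le> real n" "real n \<le> 4 * real m ^ 2"
proof -
  have "1 \<le> sqrt (real n)"
    using assms by simp
  then have "1 \<le> \<lfloor>sqrt (real n)\<rfloor>"
    by (simp add: le_floor_iff)
  then show m: "m \<ge> 1"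
    using assms by linarith
  have le: "real m \<le> sqrt (real n)" and less: "sqrt (real n) < real m + 1"
    using \<open>1 \<le> \<lfloor>sqrt (real n)\<rfloor>\<close> assms by linarith+
  from le show "real m ^ 2 \<le> real n"
    using power_mono[OF le, of 2] by simp
  have "sqrt (real n) \<le> 2 * real m"
    using less m by linarith
  from power_mono[OF this, of 2] show "real n \<le> 4 * real m ^ 2"
    by simp
qed

theorem mainTheorem1:
  "\<exists>c C :: real. \<exists>n0 :: nat. c > 0 \<and> C > 0 \<and>
     (\<forall>n\<ge>n0. c * real n ^ 3 * ln (real n) \<le> real (card (equal_dist_quadruples n)) \<and>
             real (card (equal_dist_quadruples n)) \<le> C * real n ^ 3 * ln (real n))"
proof (intro exI conjI allI impI)
  \<comment> \<open>\<open>1404 = 117 * 4 * 3\<close>, and \<open>8388608 = 2^23\<close> collects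
    the losses \<open>4^3\<close>, \<open>2^4\<close>, \<open>16^2\<close>, \<open>4\<close> and
    \<open>8\<close> of the lower bound.\<close>
  show "1 / 8388608 > (0::real)" "1404 > (0::real)"
    by simp_all
  fix n :: nat
  assume n: "n \<ge> 65536"
  define m where "m = nat \<lfloor>sqrt (real n)\<rfloor>"
  have m: "m \<ge> 1" "real m ^ 2 \<le> real n" "real n \<le> 4 * real m ^ 2"
    using floor_sqrt_bounds[OF m_def] n by auto
  have ln_n: "1 \<le> ln (real n)"
    using n exp_le by (subst ln_ge_iff) auto

  have "real (card (equal_dist_quadruples n)) \<le> real (m ^ 4 * card (equal_products (2 * m)))"
    using card_equal_dist_quadruples_le[OF m_def] by (simp only: of_nat_le_iff)
  also have "\<dots> \<le> real m ^ 4 * (117 * real (2 * m) ^ 2 * harm (2 * m))"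
    unfolding of_nat_mult of_nat_power using m(1)
    by (intro mult_left_mono card_equal_products_le[of "2 * m", unfolded of_nat_mult]) auto
  also have "\<dots> = 468 * (real m ^ 2) ^ 3 * harm (2 * m)"
    by (simp add: power_mult_distrib flip: power_mult power_add)
  also have "\<dots> \<le> 468 * real n ^ 3 * (3 * ln (real n))"
  proof (intro mult_mono power_mono m(2))
    have "real m \<le> real n"
      using m self_le_power[of "real m" 2] by simp
    then have "ln (real (2 * m)) \<le> ln 2 + ln (real n)"
      using m(1) by (simp add: ln_mult)
    \<comment> \<open>\<open>1 + ln 2 + ln n\<close> is at most \<open>3 * ln n\<close> because
      \<open>ln n >= 1\<close>.\<close>
    then show "harm (2 * m) \<le> 3 * ln (real n)"
      using harm_le_one_plus_ln[of "2 * m"] m(1) ln_n ln_2_less_1 by linarith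
  qed (auto intro: harm_nonneg)
  finally show "real (card (equal_dist_quadruples n)) \<le> 1404 * real n ^ 3 * ln (real n)"
    by simp

  \<comment> \<open>The largest \<open>N\<close> that the boundary margin \<open>8 * N <= m\<close>
    permits.\<close>
  define N where "N = m div 8"
  have "8 ^ 2 \<le> real m ^ 2"
    using m(3) n by simp
  then have "8 \<le> m"
    by (subst (asm) power_mono_iff) auto
  then have "m \<le> 16 * N" "m \<le> 8 * N + 8" "8 * N \<le> m"
    unfolding N_def by presburger+
  then have N: "real m / 16 \<le> real N" "real m / 8 \<le> real N + 1" "8 * N \<le> m"
    by linarith+
  \<comment> \<open>From \<open>n <= 4 * m^2 = 256 * (m / 8)^2\<close>. The threshold
    \<open>65536 = 16^4\<close> makes the extra \<open>2 * ln 16\<close> at most half of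
    \<open>ln n\<close>.\<close>
  have "ln (real n) / 4 \<le> ln (real m / 8)"
  proof -
    have "ln (65536 :: real) \<le> ln (real n)"
      using n by simp
    moreover have "ln (65536 :: real) = 4 * ln 16"
      using ln_realpow[of 16 4] by simp
    moreover have "ln (real n) \<le> ln (256 * (real m / 8) ^ 2)"
      using m n by (simp add: power_divide)
    then have "ln (real n) \<le> ln (16 ^ 2) + 2 * ln (real m / 8)"
      using m(1) by (simp add: ln_mult ln_realpow)
    then have "ln (real n) \<le> 2 * ln 16 + 2 * ln (real m / 8)"
      by (simp only: ln_realpow)
    ultimately show ?thesis
      by linarith
  qed
  also have "\<dots> \<le> ln (real N + 1)"
    using N m(1) by simp
  also have "\<dots> \<le> harm N"
    by (rule ln_le_harm)
  finally have harm: "ln (real n) / 4 \<le> harm N" .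
  have "1 / 8388608 * real n ^ 3 * ln (real n) \<le> 1 / 8388608 * (4 * real m ^ 2) ^ 3 * ln (real n)"
    using m(3) ln_n by (intro mult_right_mono mult_left_mono power_mono) auto
  also have "\<dots> = (real m / 2) ^ 4 * ((real m / 16) ^ 2 * (ln (real n) / 4) / 8)"
    by (simp add: field_simps flip: power_mult power_add)
  also have "\<dots> \<le> (real m / 2) ^ 4 * (real N ^ 2 * harm N / 8)"
    using N harm ln_n by (intro mult_left_mono divide_right_mono mult_mono power_mono) auto
  also have "\<dots> \<le> (real m / 2) ^ 4 * real (card (positive_equal_products N))"
    by (intro mult_left_mono card_positive_equal_products_ge) auto
  also have "\<dots> \<le> real (card (equal_dist_quadruples n))"
    by (rule card_equal_dist_quadruples_ge[OF m_def N(3)])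
  finally show "1 / 8388608 * real n ^ 3 * ln (real n) \<le> real (card (equal_dist_quadruples n))" .
qed

end
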